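(* Let $\mathcal I$ be an ideal on $\omega$. If $\mathcal I\le_K\mathcal Z\times\mathrm{Fin}$, then $\mathcal I$ is not Grothendieck.
   Context: All ideals are proper and contain all finite subsets of their (countable) base set. $\mathcal Z=\{A\subseteq\omega:\lim_{n\to\infty}|A\cap[2^n,2^{n+1})|/2^n=0\}$ and $\mathrm{Fin}=[\omega]^{<\omega}$. For ideals $\mathcal I,\mathcal J$ on $\omega$, $\mathcal I\times\mathcal J=\{A\subseteq\omega^2:\{n:\{m:(n,m)\in A\}\notin\mathcal J\}\in\mathcal I\}$. For an ideal $\mathcal I$ on $D$ and an ideal $\mathcal J$ on $E$, $\mathcal I\le_K\mathcal J$ (Katětov order) means there is $f:E\to D$ with $f^{-1}(A)\in\mathcal J$ for every $A\in\mathcal I$. An ideal $\mathcal I$ on $\omega$ is Grothendieck if the Banach space $c_{0,\mathcal I}=\{(x_n)\in\ell_\infty:\ \forall\epsilon>0\ \{n:|x_n|\ge\epsilon\}\in\mathcal I\}$ (supremum norm) is Grothendieck, i.e. every weak$^*$ null sequence in its dual is weakly null. *)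

theory Defs
  imports "HOL-Analysis.Analysis"
begin

section \<open>Ideals\<close>

text \<open>The base set of an ideal is the whole type.\<close>

definition is_ideal :: "'a set set \<Rightarrow> bool" where
  "is_ideal I \<longleftrightarrow>
     (\<forall>A. finite A \<longrightarrow> A \<in> I) \<and>
     (\<forall>A B. A \<in> I \<and> B \<subseteq> A \<longrightarrow> B \<in> I) \<and>
     (\<forall>A B. A \<in> I \<and> B \<in> I \<longrightarrow> A \<union> B \<in> I) \<and>
     UNIV \<notin> I"

definition Fin_ideal :: "nat set set" where
  "Fin_ideal = {A. finite A}"

definition Z_ideal :: "nat set set" where
  "Z_ideal = {A. (\<lambda>n. real (card (A \<inter> {2 ^ n..<2 ^ (n + 1)})) / 2 ^ n) \<longlonglongrightarrow> 0}"

definition ideal_times :: "nat set set \<Rightarrow> nat set set \<Rightarrow> (nat \<times> nat) set set" where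
  "ideal_times I J = {A. {n. {m. (n, m) \<in> A} \<notin> J} \<in> I}"

definition katetov_le :: "'d set set \<Rightarrow> 'e set set \<Rightarrow> bool" where
  "katetov_le I J \<longleftrightarrow> (\<exists>f :: 'e \<Rightarrow> 'd. \<forall>A\<in>I. f -` A \<in> J)"

section \<open>Grothendieck spaces\<close>

text \<open>
  The spaces of interest are linear subspaces \<open>X\<close> of a normed space and depend on a parameter, so
  they are given as sets, and their duals as sets of functions. A functional on \<open>X\<close> is extended by
  the value 0 outside \<open>X\<close>; it is then determined by its restriction to \<open>X\<close>, and the vector space
  operations of the dual are the pointwise ones.
\<close>

definition dual_space :: "'a::real_normed_vector set \<Rightarrow> ('a \<Rightarrow> real) set" where
  "dual_space X = {f.
     (\<forall>x\<in>X. \<forall>y\<in>X. f (x + y) = f x + f y) \<and>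
     (\<forall>c. \<forall>x\<in>X. f (c *\<^sub>R x) = c * f x) \<and>
     (\<exists>K. \<forall>x\<in>X. \<bar>f x\<bar> \<le> K * norm x) \<and>
     (\<forall>x. x \<notin> X \<longrightarrow> f x = 0)}"

definition dual_norm :: "'a::real_normed_vector set \<Rightarrow> ('a \<Rightarrow> real) \<Rightarrow> real" where
  "dual_norm X f = (SUP x\<in>{x\<in>X. norm x \<le> 1}. \<bar>f x\<bar>)"

text \<open>Here the values outside \<^term>\<open>dual_space X\<close> are left unconstrained, as they are never used.\<close>

definition bidual_space :: "'a::real_normed_vector set \<Rightarrow> (('a \<Rightarrow> real) \<Rightarrow> real) set" where
  "bidual_space X = {\<phi>.
     (\<forall>f\<in>dual_space X. \<forall>g\<in>dual_space X. \<phi> (\<lambda>x. f x + g x) = \<phi> f + \<phi> g) \<and>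
     (\<forall>c. \<forall>f\<in>dual_space X. \<phi> (\<lambda>x. c * f x) = c * \<phi> f) \<and>
     (\<exists>K. \<forall>f\<in>dual_space X. \<bar>\<phi> f\<bar> \<le> K * dual_norm X f)}"

definition weak_star_null :: "'a::real_normed_vector set \<Rightarrow> (nat \<Rightarrow> 'a \<Rightarrow> real) \<Rightarrow> bool" where
  "weak_star_null X f \<longleftrightarrow> (\<forall>n. f n \<in> dual_space X) \<and> (\<forall>x\<in>X. (\<lambda>n. f n x) \<longlonglongrightarrow> 0)"

definition weakly_null_in_dual :: "'a::real_normed_vector set \<Rightarrow> (nat \<Rightarrow> 'a \<Rightarrow> real) \<Rightarrow> bool" where
  "weakly_null_in_dual X f \<longleftrightarrow>
     (\<forall>n. f n \<in> dual_space X) \<and> (\<forall>\<phi>\<in>bidual_space X. (\<lambda>n. \<phi> (f n)) \<longlonglongrightarrow> 0)"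

definition grothendieck_space :: "'a::real_normed_vector set \<Rightarrow> bool" where
  "grothendieck_space X \<longleftrightarrow> (\<forall>f. weak_star_null X f \<longrightarrow> weakly_null_in_dual X f)"

section \<open>Grothendieck ideals\<close>

text \<open>
  Since \<^typ>\<open>nat\<close> is discrete, the type of bounded continuous functions from \<^typ>\<open>nat\<close> to
  \<^typ>\<open>real\<close> is the real Banach space of all bounded sequences with the supremum norm.
\<close>

definition c0_ideal :: "nat set set \<Rightarrow> (nat \<Rightarrow>\<^sub>C real) set" where
  "c0_ideal I = {x. \<forall>\<epsilon>>0. {n. \<bar>apply_bcontfun x n\<bar> \<ge> \<epsilon>} \<in> I}"

definition grothendieck_ideal :: "nat set set \<Rightarrow> bool" where
  "grothendieck_ideal I \<longleftrightarrow> grothendieck_space (c0_ideal I)"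

end

theory Submission
  imports Defs
begin

text \<open>
  Let \<open>f\<close> witness the Katetov reduction, and call \<open>m \<mapsto> f (n, m)\<close> the \<open>n\<close>-th column. For every
  \<open>A \<in> I\<close> the set of columns that meet \<open>A\<close> infinitely often is in \<open>\<Z>\<close>. Let \<open>P\<close> be the set of
  all columns that meet some set of \<open>I\<close> infinitely often; two cases arise.

  If \<open>P \<in> \<Z>\<close>, then some column \<open>g\<close> lies outside \<open>P\<close>, so it meets each set of \<open>I\<close> only
  finitely often. Hence \<open>x (g m) \<longlonglongrightarrow> 0\<close> for every \<open>x \<in> c\<^sub>0\<^sub>,\<^sub>I\<close>, and the point evaluations at
  \<open>g m\<close> are weak* null (\<open>not_grothendieck_ideal_if_sequence\<close>).

  If \<open>P \<notin> \<Z>\<close>, each column \<open>n \<in> P\<close> is thinned out so that it runs inside one set \<open>A n \<in> I\<close>.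
  Let \<open>l\<^sub>n x\<close> be a generalized limit of \<open>x\<close> along the thinned column, and average:
  \<open>F\<^sub>k = 2\<^sup>-\<^sup>k * (\<Sum>n\<in>P \<inter> [2\<^sup>k, 2\<^sup>k\<^sup>+\<^sup>1). l\<^sub>n)\<close>. Given \<open>x\<close> and \<open>\<epsilon>\<close>, the columns with
  \<open>\<bar>l\<^sub>n x\<bar> > \<epsilon>\<close> all meet \<open>{\<bar>x\<bar> \<ge> \<epsilon>} \<in> I\<close> infinitely often and so form a set in \<open>\<Z>\<close>; this makes
  \<open>F\<^sub>k\<close> weak* null. Its value on the characteristic function of a large finite union of the \<open>A n\<close>
  is the density of \<open>P\<close> in the \<open>k\<close>-th block, which does not tend to \<open>0\<close>
  (\<open>not_grothendieck_ideal_if_columns\<close>).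

  In both cases mass survives: there are sets \<open>A\<^sub>j \<in> I\<close> such that the value of the \<open>k\<close>-th functional
  on the characteristic function of \<open>A\<^sub>j\<close> is eventually (in \<open>j\<close>) a number \<open>c\<^sub>k\<close>, and \<open>c\<^sub>k\<close> does
  not tend to \<open>0\<close>. The generalized limit over \<open>j\<close> of \<open>\<mu> (\<chi>\<^bsub>A\<^sub>j\<^esub>)\<close> is a bounded linear functional of
  \<open>\<mu>\<close>, hence an element of the bidual that refutes weak nullity
  (\<open>not_grothendieck_ideal_criterion\<close>).
\<close>

section \<open>Generalized limits of bounded sequences\<close>

text \<open>
  By Tychonoff the evaluations \<open>h \<mapsto> h i\<close> have a cluster point \<open>L\<close> in the product topology. Each
  asserted property is a closed condition on finitely many coordinates of \<open>L\<close> that holds for all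
  sufficiently late evaluations, so \<open>L\<close> inherits it.
\<close>

lemma generalized_limit:
  obtains L :: "(nat \<Rightarrow> real) \<Rightarrow> real"
  where "\<And>g h. Bseq g \<Longrightarrow> Bseq h \<Longrightarrow> L (\<lambda>i. g i + h i) = L g + L h"
    and "\<And>c h. Bseq h \<Longrightarrow> L (\<lambda>i. c * h i) = c * L h"
    and "\<And>b h. Bseq h \<Longrightarrow> \<forall>\<^sub>F i in sequentially. \<bar>h i\<bar> \<le> b \<Longrightarrow> \<bar>L h\<bar> \<le> b"
    and "\<And>c h. Bseq h \<Longrightarrow> \<forall>\<^sub>F i in sequentially. h i = c \<Longrightarrow> L h = c"
proof -
  \<comment> \<open>Evaluation is cut off to \<open>0\<close> at unbounded sequences, so that every coordinate stays bounded.\<close>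
  define e :: "nat \<Rightarrow> (nat \<Rightarrow> real) \<Rightarrow> real" where "e = (\<lambda>i h. if Bseq h then h i else 0)"
  have "\<exists>B. \<forall>i. \<bar>e i h\<bar> \<le> B" for h
  proof (cases "Bseq h")
    case True
    then show ?thesis
      by (auto simp: e_def Bseq_def)
  next
    case False
    then show ?thesis
      by (intro exI[of _ 0]) (simp add: e_def)
  qed
  then obtain B where B: "\<And>h i. \<bar>e i h\<bar> \<le> B h"
    by metis
  define K where "K = (\<Pi>\<^sub>E h\<in>UNIV. {- B h..B h})"
  have "compact K"
    using compactin_PiE[of "\<lambda>_::nat \<Rightarrow> real. euclidean :: real topology" UNIV "\<lambda>h. {- B h..B h}"]
    by (simp add: K_def euclidean_product_topology)
  moreover have "\<forall>\<^sub>F x in filtermap e sequentially. x \<in> K"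
    using B by (simp add: K_def eventually_filtermap PiE_iff abs_le_iff minus_le_iff)
  moreover have "filtermap e sequentially \<noteq> bot"
    by (simp add: filtermap_bot_iff)
  ultimately obtain L where L: "inf (nhds L) (filtermap e sequentially) \<noteq> bot"
    unfolding compact_filter by blast
  have cluster: "P L" if "closed (Collect P)" "\<forall>\<^sub>F i in sequentially. P (e i)" for P
  proof (rule ccontr)
    assume "\<not> P L"
    then have "\<forall>\<^sub>F x in nhds L. \<not> P x"
      using that(1) eventually_nhds_in_open[of "- Collect P" L] by (simp add: open_closed)
    moreover have "\<forall>\<^sub>F x in filtermap e sequentially. P x"
      using that(2) by (simp add: eventually_filtermap)
    ultimately have "eventually (\<lambda>_. False) (inf (nhds L) (filtermap e sequentially))"
      unfolding eventually_inf by blast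
    then show False
      using L by (simp add: trivial_limit_def)
  qed
  note cont = continuous_on_product_coordinates[where 'b = real and 'a = "nat \<Rightarrow> real"]
  show thesis
  proof (rule that[of L])
    show "L (\<lambda>i. g i + h i) = L g + L h" if "Bseq g" "Bseq h" for g h
    proof (rule cluster)
      show "closed {M::(nat \<Rightarrow> real) \<Rightarrow> real. M (\<lambda>i. g i + h i) = M g + M h}"
        by (intro closed_Collect_eq continuous_on_add cont)
      have "Bseq (\<lambda>i. g i + h i)"
      proof -
        obtain C D where "\<And>i. norm (g i) \<le> C" "\<And>i. norm (h i) \<le> D"
          using \<open>Bseq g\<close> \<open>Bseq h\<close> unfolding Bseq_def by blast
        then show ?thesis
          by (intro BseqI'[of _ "C + D"]) (rule norm_triangle_mono)
      qed
      then show "\<forall>\<^sub>F i in sequentially. e i (\<lambda>i. g i + h i) = e i g + e i h"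
        using that by (simp add: e_def)
    qed
    show "L (\<lambda>i. c * h i) = c * L h" if "Bseq h" for c h
    proof (rule cluster)
      show "closed {M::(nat \<Rightarrow> real) \<Rightarrow> real. M (\<lambda>i. c * h i) = c * M h}"
        by (intro closed_Collect_eq continuous_on_mult continuous_on_const cont)
      have "Bseq (\<lambda>i. c * h i)"
        using that by (intro Bseq_mult) auto
      then show "\<forall>\<^sub>F i in sequentially. e i (\<lambda>i. c * h i) = c * e i h"
        using that by (simp add: e_def)
    qed
    show "\<bar>L h\<bar> \<le> b" if "Bseq h" "\<forall>\<^sub>F i in sequentially. \<bar>h i\<bar> \<le> b" for b h
    proof (rule cluster)
      show "closed {M::(nat \<Rightarrow> real) \<Rightarrow> real. \<bar>M h\<bar> \<le> b}"
        by (intro closed_Collect_le continuous_on_rabs continuous_on_const cont)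
    qed (use that in \<open>simp add: e_def\<close>)
    show "L h = c" if "Bseq h" "\<forall>\<^sub>F i in sequentially. h i = c" for c h
    proof (rule cluster)
      show "closed {M::(nat \<Rightarrow> real) \<Rightarrow> real. M h = c}"
        by (intro closed_Collect_eq continuous_on_const cont)
    qed (use that in \<open>simp add: e_def\<close>)
  qed
qed

section \<open>A criterion for failing the Grothendieck property\<close>

definition char_bcontfun :: "nat set \<Rightarrow> nat \<Rightarrow>\<^sub>C real" where
  "char_bcontfun A = Bcontfun (indicator A)"

lemma apply_char_bcontfun [simp]: "apply_bcontfun (char_bcontfun A) n = indicator A n"
proof -
  have "indicator A \<in> (bcontfun :: (nat \<Rightarrow> real) set)"
    by (rule bcontfun_normI[of _ 1]) (auto simp: indicator_def)
  then show ?thesis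
    by (simp add: char_bcontfun_def Bcontfun_inverse)
qed

lemma norm_char_bcontfun_le: "norm (char_bcontfun A) \<le> 1"
  by (rule norm_bound) (simp add: indicator_def)

lemma abs_apply_bcontfun_le: "\<bar>apply_bcontfun x n\<bar> \<le> norm x" for x :: "nat \<Rightarrow>\<^sub>C real"
  using norm_bounded[of x n] by simp

lemma Bseq_apply_bcontfun: "Bseq (\<lambda>i. apply_bcontfun x (g i))" for x :: "nat \<Rightarrow>\<^sub>C real"
  by (rule BseqI'[of _ "norm x"]) (rule norm_bounded)

lemma c0_ideal_superlevel:
  "x \<in> c0_ideal I \<Longrightarrow> \<epsilon> > 0 \<Longrightarrow> {n. \<bar>apply_bcontfun x n\<bar> \<ge> \<epsilon>} \<in> I"
  unfolding c0_ideal_def by blast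

context
  fixes I :: "nat set set"
  assumes ideal: "is_ideal I"
begin

lemma ideal_finite: "finite A \<Longrightarrow> A \<in> I"
  and ideal_subset: "A \<in> I \<Longrightarrow> B \<subseteq> A \<Longrightarrow> B \<in> I"
  and ideal_Un: "A \<in> I \<Longrightarrow> B \<in> I \<Longrightarrow> A \<union> B \<in> I"
  using ideal unfolding is_ideal_def by blast+

lemma ideal_UN: "finite N \<Longrightarrow> (\<And>n. n \<in> N \<Longrightarrow> A n \<in> I) \<Longrightarrow> (\<Union>n\<in>N. A n) \<in> I"
  by (induction N rule: finite_induct) (auto intro: ideal_finite ideal_Un)

lemma c0_ideal_add:
  assumes "x \<in> c0_ideal I" "y \<in> c0_ideal I"
  shows "x + y \<in> c0_ideal I"
  unfolding c0_ideal_def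
proof (intro CollectI allI impI)
  fix \<epsilon> :: real
  assume "\<epsilon> > 0"
  then have "{n. \<bar>apply_bcontfun x n\<bar> \<ge> \<epsilon> / 2} \<union> {n. \<bar>apply_bcontfun y n\<bar> \<ge> \<epsilon> / 2} \<in> I"
    by (intro ideal_Un c0_ideal_superlevel assms) simp_all
  then show "{n. \<bar>apply_bcontfun (x + y) n\<bar> \<ge> \<epsilon>} \<in> I"
    by (rule ideal_subset) (auto simp: plus_bcontfun.rep_eq)
qed

lemma c0_ideal_scaleR:
  assumes "x \<in> c0_ideal I"
  shows "c *\<^sub>R x \<in> c0_ideal I"
  unfolding c0_ideal_def
proof (intro CollectI allI impI)
  fix \<epsilon> :: real
  assume "\<epsilon> > 0"
  show "{n. \<bar>apply_bcontfun (c *\<^sub>R x) n\<bar> \<ge> \<epsilon>} \<in> I"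
  proof (cases "c = 0")
    case True
    then show ?thesis
      using \<open>\<epsilon> > 0\<close> by (simp add: ideal_finite)
  next
    case False
    then have "{n. \<bar>apply_bcontfun x n\<bar> \<ge> \<epsilon> / \<bar>c\<bar>} \<in> I"
      using assms \<open>\<epsilon> > 0\<close> unfolding c0_ideal_def by auto
    then show ?thesis
      using False by (simp add: scaleR_bcontfun.rep_eq abs_mult divide_le_eq mult.commute)
  qed
qed

lemma char_bcontfun_in_c0_ideal:
  assumes "A \<in> I"
  shows "char_bcontfun A \<in> c0_ideal I"
  unfolding c0_ideal_def
  by (auto intro!: ideal_subset[OF assms] simp: indicator_def split: if_splits)

text \<open>
  The functionals are given on all bounded sequences and are restricted to \<open>c\<^sub>0\<^sub>,\<^sub>I\<close>. Characteristic
  functions of sets in \<open>I\<close> belong to its unit ball, so a generalized limit of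
  \<open>\<mu> (\<chi>\<^bsub>A\<^sub>j\<^esub>)\<close> over \<open>j\<close> defines an element of the bidual, and this element takes the value \<open>c k\<close> at
  the \<open>k\<close>-th functional.
\<close>

lemma not_grothendieck_ideal_criterion:
  fixes F :: "nat \<Rightarrow> (nat \<Rightarrow>\<^sub>C real) \<Rightarrow> real"
  assumes add: "\<And>k x y. F k (x + y) = F k x + F k y"
    and scale: "\<And>k c x. F k (c *\<^sub>R x) = c * F k x"
    and bound: "\<And>k x. \<bar>F k x\<bar> \<le> norm x"
    and null: "\<And>x. x \<in> c0_ideal I \<Longrightarrow> (\<lambda>k. F k x) \<longlonglongrightarrow> 0"
    and A: "\<And>j. A j \<in> I"
    and mass: "\<And>k. \<forall>\<^sub>F j in sequentially. F k (char_bcontfun (A j)) = c k"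
    and c: "\<not> c \<longlonglongrightarrow> 0"
  shows "\<not> grothendieck_ideal I"
proof
  assume groth: "grothendieck_ideal I"
  define X where "X = c0_ideal I"
  define f where "f = (\<lambda>k x. if x \<in> X then F k x else 0)"
  have f_dual: "f k \<in> dual_space X" for k
  proof -
    have "\<exists>K. \<forall>x\<in>X. \<bar>F k x\<bar> \<le> K * norm x"
      using bound by (intro exI[of _ 1]) simp
    then show ?thesis
      by (simp add: dual_space_def f_def X_def c0_ideal_add c0_ideal_scaleR add scale)
  qed
  have "weak_star_null X f"
    using f_dual null by (simp add: weak_star_null_def f_def X_def)
  with groth have weakly_null: "weakly_null_in_dual X f"
    by (simp add: grothendieck_ideal_def grothendieck_space_def X_def)

  obtain L :: "(nat \<Rightarrow> real) \<Rightarrow> real" where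
    L_add: "\<And>g h. Bseq g \<Longrightarrow> Bseq h \<Longrightarrow> L (\<lambda>i. g i + h i) = L g + L h"
    and L_scale: "\<And>c h. Bseq h \<Longrightarrow> L (\<lambda>i. c * h i) = c * L h"
    and L_bound: "\<And>b h. Bseq h \<Longrightarrow> \<forall>\<^sub>F i in sequentially. \<bar>h i\<bar> \<le> b \<Longrightarrow> \<bar>L h\<bar> \<le> b"
    and L_const: "\<And>c h. Bseq h \<Longrightarrow> \<forall>\<^sub>F i in sequentially. h i = c \<Longrightarrow> L h = c"
    by (rule generalized_limit) blast
  define T where "T = (\<lambda>\<mu> :: (nat \<Rightarrow>\<^sub>C real) \<Rightarrow> real. L (\<lambda>j. \<mu> (char_bcontfun (A j))))"
  have char_X: "char_bcontfun (A j) \<in> X" for j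
    using A by (simp add: X_def char_bcontfun_in_c0_ideal)
  have dual_norm_ge: "\<bar>\<mu> (char_bcontfun (A j))\<bar> \<le> dual_norm X \<mu>" if \<mu>: "\<mu> \<in> dual_space X" for \<mu> j
  proof -
    obtain K where K: "\<And>x. x \<in> X \<Longrightarrow> \<bar>\<mu> x\<bar> \<le> K * norm x"
      using \<mu> unfolding dual_space_def by blast
    have "\<bar>\<mu> x\<bar> \<le> \<bar>K\<bar>" if "x \<in> X" "norm x \<le> 1" for x
    proof -
      have "\<bar>\<mu> x\<bar> \<le> \<bar>K\<bar> * norm x"
        using K[OF that(1)] abs_ge_self[of K] by (meson mult_right_mono norm_ge_zero order_trans)
      also have "\<dots> \<le> \<bar>K\<bar> * 1"
        using that(2) by (intro mult_left_mono) auto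
      finally show ?thesis by simp
    qed
    then have "bdd_above ((\<lambda>x. \<bar>\<mu> x\<bar>) ` {x \<in> X. norm x \<le> 1})"
      by (intro bdd_aboveI[of _ "\<bar>K\<bar>"]) auto
    then show ?thesis
      unfolding dual_norm_def using char_X norm_char_bcontfun_le by (intro cSUP_upper) auto
  qed
  then have Bseq_dual: "Bseq (\<lambda>j. \<mu> (char_bcontfun (A j)))" if "\<mu> \<in> dual_space X" for \<mu>
    using that by (intro BseqI'[of _ "dual_norm X \<mu>"]) simp
  have "T \<in> bidual_space X"
    unfolding bidual_space_def
  proof (intro CollectI conjI ballI allI exI)
    fix \<mu> assume \<mu>: "\<mu> \<in> dual_space X"
    show "T (\<lambda>x. c * \<mu> x) = c * T \<mu>" for c
      unfolding T_def by (intro L_scale Bseq_dual \<mu>)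
    show "\<bar>T \<mu>\<bar> \<le> 1 * dual_norm X \<mu>"
      unfolding T_def by (intro L_bound Bseq_dual \<mu>) (simp add: dual_norm_ge \<mu>)
    show "T (\<lambda>x. \<mu> x + \<nu> x) = T \<mu> + T \<nu>" if "\<nu> \<in> dual_space X" for \<nu>
      unfolding T_def by (intro L_add Bseq_dual \<mu> that)
  qed
  with weakly_null have "(\<lambda>k. T (f k)) \<longlonglongrightarrow> 0"
    by (simp add: weakly_null_in_dual_def)
  moreover have "T (f k) = c k" for k
    unfolding T_def using mass[of k] char_X
    by (intro L_const Bseq_dual f_dual) (simp add: f_def)
  ultimately show False
    using c by simp
qed

end

section \<open>Ideals below the product\<close>

definition block :: "nat \<Rightarrow> nat set" where
  "block k = {2 ^ k..<2 ^ (k + 1)}"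

lemma finite_block [simp]: "finite (block k)"
  and card_block [simp]: "card (block k) = 2 ^ k"
  by (simp_all add: block_def)

lemma Z_ideal_iff_block:
  "A \<in> Z_ideal \<longleftrightarrow> (\<lambda>k. real (card (A \<inter> block k)) / 2 ^ k) \<longlonglongrightarrow> 0"
  by (simp add: Z_ideal_def block_def)

lemma UNIV_notin_Z_ideal: "UNIV \<notin> Z_ideal"
  by (simp add: Z_ideal_iff_block LIMSEQ_const_iff)

lemma Z_ideal_subset:
  assumes "A \<subseteq> B" and B: "B \<in> Z_ideal"
  shows "A \<in> Z_ideal"
  unfolding Z_ideal_iff_block
proof (rule tendsto_sandwich[OF _ _ tendsto_const])
  show "(\<lambda>k. real (card (B \<inter> block k)) / 2 ^ k) \<longlonglongrightarrow> 0"
    using B by (simp add: Z_ideal_iff_block)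
  have "card (A \<inter> block k) \<le> card (B \<inter> block k)" for k
    using \<open>A \<subseteq> B\<close> by (intro card_mono) auto
  then show "\<forall>\<^sub>F k in sequentially. real (card (A \<inter> block k)) / 2 ^ k \<le> real (card (B \<inter> block k)) / 2 ^ k"
    by (simp add: divide_right_mono)
qed simp

text \<open>
  The point evaluations at \<open>g m\<close> are weak* null, since a superlevel set of \<open>x\<close> is visited only
  finitely often, yet each of them gives mass \<open>1\<close> to the finite set \<open>g ` {..j}\<close> as soon as \<open>j \<ge> m\<close>.
\<close>

lemma not_grothendieck_ideal_if_sequence:
  fixes g :: "nat \<Rightarrow> nat"
  assumes I: "is_ideal I" and g: "\<And>A. A \<in> I \<Longrightarrow> finite {m. g m \<in> A}"
  shows "\<not> grothendieck_ideal I"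
proof (rule not_grothendieck_ideal_criterion[OF I,
      where F = "\<lambda>m x. apply_bcontfun x (g m)" and A = "\<lambda>j. g ` {..j}" and c = "\<lambda>_. 1"])
  show "(\<lambda>m. apply_bcontfun x (g m)) \<longlonglongrightarrow> 0" if "x \<in> c0_ideal I" for x
  proof (rule tendstoI)
    fix \<epsilon> :: real
    assume "\<epsilon> > 0"
    then have "finite {m. g m \<in> {n. \<bar>apply_bcontfun x n\<bar> \<ge> \<epsilon>}}"
      by (intro g c0_ideal_superlevel that)
    then show "\<forall>\<^sub>F m in sequentially. dist (apply_bcontfun x (g m)) 0 < \<epsilon>"
      by (simp add: eventually_cofinite not_less flip: cofinite_eq_sequentially)
  qed
  show "\<forall>\<^sub>F j in sequentially. apply_bcontfun (char_bcontfun (g ` {..j})) (g k) = 1" for k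
    using eventually_ge_at_top[of k] by eventually_elim (simp add: indicator_def)
qed (auto simp: abs_apply_bcontfun_le ideal_finite[OF I] plus_bcontfun.rep_eq
      scaleR_bcontfun.rep_eq LIMSEQ_const_iff)

text \<open>
  The averages over dyadic blocks of generalized limits along the columns are weak* null because
  only few columns can see that \<open>x\<close> is not small. Confining the \<open>n\<close>-th column to \<open>A n\<close> is what
  prevents the limits from vanishing on \<open>c\<^sub>0\<^sub>,\<^sub>I\<close>: the \<open>n\<close>-th limit gives mass \<open>1\<close> to \<open>A n\<close>.
  A limit functional is used, and not point evaluations \<open>x (g n m)\<close> for one fixed \<open>m\<close>, since the index
  from which a column avoids \<open>{\<bar>x\<bar> \<ge> \<epsilon>}\<close> depends on \<open>x\<close>.
\<close>

lemma not_grothendieck_ideal_if_columns: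
  fixes g :: "nat \<Rightarrow> nat \<Rightarrow> nat" and P :: "nat set"
  assumes I: "is_ideal I" and P: "P \<notin> Z_ideal"
    and A: "\<And>n. n \<in> P \<Longrightarrow> A n \<in> I"
    and gA: "\<And>n m. n \<in> P \<Longrightarrow> g n m \<in> A n"
    and small: "\<And>B. B \<in> I \<Longrightarrow> {n \<in> P. infinite {m. g n m \<in> B}} \<in> Z_ideal"
  shows "\<not> grothendieck_ideal I"
proof -
  obtain L :: "(nat \<Rightarrow> real) \<Rightarrow> real" where
    L_add: "\<And>g h. Bseq g \<Longrightarrow> Bseq h \<Longrightarrow> L (\<lambda>i. g i + h i) = L g + L h"
    and L_scale: "\<And>c h. Bseq h \<Longrightarrow> L (\<lambda>i. c * h i) = c * L h"
    and L_bound: "\<And>b h. Bseq h \<Longrightarrow> \<forall>\<^sub>F i in sequentially. \<bar>h i\<bar> \<le> b \<Longrightarrow> \<bar>L h\<bar> \<le> b"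
    and L_const: "\<And>c h. Bseq h \<Longrightarrow> \<forall>\<^sub>F i in sequentially. h i = c \<Longrightarrow> L h = c"
    by (rule generalized_limit) blast
  define l where "l = (\<lambda>n x. L (\<lambda>m. apply_bcontfun x (g n m)))"
  define F where "F = (\<lambda>k x. (\<Sum>n\<in>P \<inter> block k. l n x) / 2 ^ k)"
  have l_norm: "\<bar>l n x\<bar> \<le> norm x" for n x
    unfolding l_def by (intro L_bound Bseq_apply_bcontfun) (simp add: abs_apply_bcontfun_le)
  show ?thesis
  proof (rule not_grothendieck_ideal_criterion[OF I, where F = F
        and A = "\<lambda>j. \<Union>n\<in>P \<inter> {..<2 ^ (j + 1)}. A n" and c = "\<lambda>k. real (card (P \<inter> block k)) / 2 ^ k"])
    show "F k (x + y) = F k x + F k y" for k x y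
      by (simp add: F_def l_def plus_bcontfun.rep_eq L_add Bseq_apply_bcontfun sum.distrib
          add_divide_distrib)
    show "F k (c *\<^sub>R x) = c * F k x" for k c x
      by (simp add: F_def l_def scaleR_bcontfun.rep_eq L_scale Bseq_apply_bcontfun sum_distrib_left)
    show "\<bar>F k x\<bar> \<le> norm x" for k x
    proof -
      have "\<bar>\<Sum>n\<in>P \<inter> block k. l n x\<bar> \<le> (\<Sum>n\<in>P \<inter> block k. norm x)"
        by (rule order_trans[OF sum_abs]) (intro sum_mono l_norm)
      also have "\<dots> \<le> (\<Sum>n\<in>block k. norm x)"
        by (intro sum_mono2) auto
      finally show ?thesis
        by (simp add: F_def abs_divide divide_le_eq mult.commute)
    qed
    \<comment> \<open>The bound \<open>2 ^ (j + 1)\<close> is the end of the \<open>j\<close>-th block: the \<open>j\<close>-th union covers all columns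
      of the blocks up to \<open>j\<close>.\<close>
    show "(\<Union>n\<in>P \<inter> {..<2 ^ (j + 1)}. A n) \<in> I" for j
      using A by (intro ideal_UN[OF I]) auto
    show "\<forall>\<^sub>F j in sequentially. F k (char_bcontfun (\<Union>n\<in>P \<inter> {..<2 ^ (j + 1)}. A n))
        = real (card (P \<inter> block k)) / 2 ^ k" for k
      using eventually_ge_at_top[of k]
    proof eventually_elim
      case (elim j)
      have "l n (char_bcontfun (\<Union>n\<in>P \<inter> {..<2 ^ (j + 1)}. A n)) = 1" if n: "n \<in> P \<inter> block k" for n
      proof -
        have "n < 2 ^ (k + 1)"
          using n by (simp add: block_def)
        also have "(2::nat) ^ (k + 1) \<le> 2 ^ (j + 1)"
          using elim by (intro power_increasing) auto
        finally have "g n m \<in> (\<Union>n\<in>P \<inter> {..<2 ^ (j + 1)}. A n)" for m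
          using n gA by blast
        then show ?thesis
          unfolding l_def by (intro L_const Bseq_apply_bcontfun) (simp add: indicator_def)
      qed
      then show ?case
        by (simp add: F_def)
    qed
    show "\<not> (\<lambda>k. real (card (P \<inter> block k)) / 2 ^ k) \<longlonglongrightarrow> 0"
      using P by (simp add: Z_ideal_iff_block)
    show "(\<lambda>k. F k x) \<longlonglongrightarrow> 0" if x: "x \<in> c0_ideal I" for x
    proof (rule tendstoI)
      fix \<epsilon> :: real
      assume \<epsilon>: "\<epsilon> > 0"
      \<comment> \<open>Columns in \<open>S\<close> contribute at most \<open>norm x\<close> but are sparse; all others at most \<open>\<epsilon> / 2\<close>.\<close>
      define S where "S = {n \<in> P. infinite {m. g n m \<in> {i. \<bar>apply_bcontfun x i\<bar> \<ge> \<epsilon> / 2}}}"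
      have l_small: "\<bar>l n x\<bar> \<le> \<epsilon> / 2 + norm x * indicator S n" if "n \<in> P" for n
      proof (cases "n \<in> S")
        case True
        then show ?thesis
          using l_norm[of n x] \<epsilon> by simp
      next
        case False
        then have "finite {m. \<not> \<bar>apply_bcontfun x (g n m)\<bar> < \<epsilon> / 2}"
          using that by (simp add: S_def not_less)
        then have "\<forall>\<^sub>F m in sequentially. \<bar>apply_bcontfun x (g n m)\<bar> < \<epsilon> / 2"
          by (simp add: eventually_cofinite flip: cofinite_eq_sequentially)
        then have "\<bar>l n x\<bar> \<le> \<epsilon> / 2"
          unfolding l_def by (intro L_bound Bseq_apply_bcontfun) (auto elim: eventually_mono)
        then show ?thesis
          using False by simp
      qed
      have F_le: "\<bar>F k x\<bar> \<le> \<epsilon> / 2 + norm x * (real (card (S \<inter> block k)) / 2 ^ k)" for k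
      proof -
        have "\<bar>\<Sum>n\<in>P \<inter> block k. l n x\<bar> \<le> (\<Sum>n\<in>P \<inter> block k. \<epsilon> / 2 + norm x * indicator S n)"
          by (rule order_trans[OF sum_abs]) (intro sum_mono l_small, simp)
        also have "\<dots> \<le> (\<Sum>n\<in>block k. \<epsilon> / 2 + norm x * indicator S n)"
          using \<epsilon> by (intro sum_mono2) auto
        also have "\<dots> = 2 ^ k * (\<epsilon> / 2) + norm x * real (card (S \<inter> block k))"
          by (simp add: sum.distrib indicator_def sum.If_cases Int_def conj_commute
              flip: sum_distrib_left)
        finally have "\<bar>\<Sum>n\<in>P \<inter> block k. l n x\<bar> / 2 ^ k
            \<le> (2 ^ k * (\<epsilon> / 2) + norm x * real (card (S \<inter> block k))) / 2 ^ k"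
          by (rule divide_right_mono) simp
        then show ?thesis
          by (simp add: F_def abs_divide add_divide_distrib)
      qed
      have "S \<in> Z_ideal"
        unfolding S_def using \<epsilon> by (intro small c0_ideal_superlevel x) simp
      then have "(\<lambda>k. norm x * (real (card (S \<inter> block k)) / 2 ^ k)) \<longlonglongrightarrow> 0"
        unfolding Z_ideal_iff_block by (rule tendsto_mult_right_zero)
      then have "\<forall>\<^sub>F k in sequentially. norm x * (real (card (S \<inter> block k)) / 2 ^ k) < \<epsilon> / 2"
        using \<epsilon> by (intro order_tendstoD(2)[where y = 0]) simp_all
      then show "\<forall>\<^sub>F k in sequentially. dist (F k x) 0 < \<epsilon>"
      proof eventually_elim
        case (elim k)
        then have "\<bar>F k x\<bar> < \<epsilon>"
          using F_le[of k] by linarith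
        then show ?case
          by simp
      qed
    qed
  qed
qed

theorem theorem2p10:
  fixes I :: "nat set set"
  assumes "is_ideal I"
    and "katetov_le I (ideal_times Z_ideal Fin_ideal)"
  shows "\<not> grothendieck_ideal I"
proof -
  obtain f :: "nat \<times> nat \<Rightarrow> nat" where
    f: "\<And>A. A \<in> I \<Longrightarrow> {n. infinite {m. f (n, m) \<in> A}} \<in> Z_ideal"
    using assms(2) by (auto simp: katetov_le_def ideal_times_def Fin_ideal_def)
  define P where "P = {n. \<exists>A\<in>I. infinite {m. f (n, m) \<in> A}}"
  show ?thesis
  proof (cases "P \<in> Z_ideal")
    case True
    then obtain n where "n \<notin> P"
      using UNIV_notin_Z_ideal by (metis UNIV_eq_I)
    then show ?thesis
      by (intro not_grothendieck_ideal_if_sequence[OF assms(1), of "\<lambda>m. f (n, m)"])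
        (auto simp: P_def)
  next
    case False
    have "\<forall>n\<in>P. \<exists>B. B \<in> I \<and> infinite {m. f (n, m) \<in> B}"
      by (auto simp: P_def)
    then obtain A where A: "\<And>n. n \<in> P \<Longrightarrow> A n \<in> I \<and> infinite {m. f (n, m) \<in> A n}"
      by (rule bchoice[THEN exE]) blast
    \<comment> \<open>\<open>r n\<close> thins the \<open>n\<close>-th column to its visits to \<open>A n\<close>.\<close>
    define r where "r = (\<lambda>n. enumerate {m. f (n, m) \<in> A n})"
    have r_in: "f (n, r n m) \<in> A n" if "n \<in> P" for n m
      using enumerate_in_set[of "{m. f (n, m) \<in> A n}" m] A[OF that] by (simp add: r_def)
    have r_inj: "inj (r n)" if "n \<in> P" for n
      using A[OF that] by (simp add: r_def strict_mono_enumerate strict_mono_imp_inj_on)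
    show ?thesis
    proof (rule not_grothendieck_ideal_if_columns[OF assms(1) False,
          where g = "\<lambda>n m. f (n, r n m)" and A = A])
      fix B assume "B \<in> I"
      have "finite {m. f (n, r n m) \<in> B}" if "n \<in> P" "finite {m. f (n, m) \<in> B}" for n
        using finite_vimageI[OF that(2) r_inj[OF that(1)]] by (simp add: vimage_def)
      then have sub: "{n \<in> P. infinite {m. f (n, r n m) \<in> B}} \<subseteq> {n. infinite {m. f (n, m) \<in> B}}"
        by blast
      show "{n \<in> P. infinite {m. f (n, r n m) \<in> B}} \<in> Z_ideal"
        using sub f[OF \<open>B \<in> I\<close>] by (rule Z_ideal_subset)
    qed (use A r_in in auto)
  qed
qed

end
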